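(* Let $B\ge1$ and $G=|\mathcal G|\ge1$ be fixed integers. In the low-SNR region the average rate of the ACC scheme is approximated by $\frac{\rho G}{B\ln2}\Psi_{G}$, in the sense that, as $\rho\to0^+$, $$\bar R^{(\mathrm{ACC})}=\frac{\rho\,G}{B\ln 2}\,\Psi_{G}+o(\rho),$$ where $$\Psi_{G}=\sum_{\|\mathbf b\|_1=G}\binom{G}{\mathbf b}\,\frac{G^{-1-\sum_{t=1}^B(t-1)b_t}}{\prod_{t=1}^B\big((t-1)!\big)^{b_t}}\,\Big(\sum_{t=1}^B(t-1)b_t\Big)!\,,$$ the sum being over all vectors $\mathbf b=[b_1,\dots,b_B]$ of $B$ non-negative integers with $b_1+\cdots+b_B=G$.
   Context: Setting: users are divided into $\Lambda$ groups of $B$ users each. $\gamma\in[0,1]$ is the normalized cache size, $\Lambda\gamma$ is an integer with $\Lambda\gamma+1\le\Lambda$, and $\mathcal G\subseteq\{1,\dots,\Lambda\}$ is a set of $G=|\mathcal G|=\Lambda\gamma+1$ groups served simultaneously. $\mathrm{SNR}_{g,b}$ denotes the instantaneous SNR of the $b$-th user of group $g$. These are i.i.d. exponential random variables with mean $\rho>0$ (density $\frac1\rho e^{-x/\rho}$, $x\ge0$). The average rate of the ACC (Aggregated Coded Caching) scheme is $$\bar R^{(\mathrm{ACC})}=\frac{G}{\ln2}\,\mathbb E\Big\{\min_{g\in\mathcal G}\frac1B\sum_{b=1}^B\ln(1+\mathrm{SNR}_{g,b})\Big\}.$$ Notation: $\binom{n}{\mathbf b}=\frac{n!}{b_1!b_2!\cdots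 b_B!}$ is the multinomial coefficient; $f(\rho)=o(\rho)$ means $\lim_{\rho\to0}f(\rho)/\rho=0$. *)

theory Defs
  imports "HOL-Probability.Probability" "HOL-Library.Landau_Symbols"
begin

text \<open>
  Users are indexed by pairs \<open>(g, b)\<close>: the \<open>b\<close>-th user of group \<open>g\<close>, with both indices
  starting at 1. \<open>SNR g b\<close> is a random variable on the probability space \<open>M\<close>.
\<close>

definition acc_avg_rate ::
  "'a measure \<Rightarrow> nat set \<Rightarrow> nat \<Rightarrow> (nat \<Rightarrow> nat \<Rightarrow> 'a \<Rightarrow> real) \<Rightarrow> real" where
  "acc_avg_rate M \<G> B SNR =
     real (card \<G>) / ln 2 *
     prob_space.expectation M
       (\<lambda>\<omega>. MIN g\<in>\<G>. 1 / real B * (\<Sum>b=1..B. ln (1 + SNR g b \<omega>)))"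

text \<open>
  Vectors \<open>[b\<^sub>1, \<dots>, b\<^sub>B]\<close> are functions on \<open>{1..B}\<close>; extensionality
  (the value outside \<open>{1..B}\<close> is fixed) makes each vector occur exactly once.
\<close>

definition weak_compositions :: "nat \<Rightarrow> nat \<Rightarrow> (nat \<Rightarrow> nat) set" where
  "weak_compositions B n = {b \<in> {1..B} \<rightarrow>\<^sub>E UNIV. (\<Sum>t=1..B. b t) = n}"

lemma finite_weak_compositions: "finite (weak_compositions B n)"
proof (rule finite_subset)
  show "weak_compositions B n \<subseteq> {1..B} \<rightarrow>\<^sub>E {..n}"
  proof
    fix b assume b: "b \<in> weak_compositions B n"
    have "b t \<le> n" if "t \<in> {1..B}" for t
      using member_le_sum[of t "{1..B}" b] that b by (auto simp: weak_compositions_def)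
    with b show "b \<in> {1..B} \<rightarrow>\<^sub>E {..n}"
      by (auto simp: weak_compositions_def PiE_iff)
  qed
qed (simp add: finite_PiE)

definition multinomial :: "nat \<Rightarrow> nat \<Rightarrow> (nat \<Rightarrow> nat) \<Rightarrow> real" where
  "multinomial B n b = fact n / (\<Prod>t=1..B. fact (b t))"

definition Psi :: "nat \<Rightarrow> nat \<Rightarrow> real" where
  "Psi B G =
     (\<Sum>b\<in>weak_compositions B G.
        multinomial B G b *
        (real G powi (- 1 - int (\<Sum>t=1..B. (t - 1) * b t)) /
         (\<Prod>t=1..B. fact (t - 1) ^ b t)) *
        fact (\<Sum>t=1..B. (t - 1) * b t))"

end

theory Submission
  imports Defs
begin

text \<open>
  To first order \<open>ln (1 + x)\<close> may be replaced by \<open>x\<close>: the error is at most \<open>x\<^sup>2\<close>, so summing it over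
  all users changes the expected minimum by \<open>O(\<rho>\<^sup>2)\<close>. After the replacement the group sums are
  independent Erlang variables with shape \<open>B\<close> and scale \<open>\<rho>\<close>, and the expectation of their minimum is
  the integral of the \<open>G\<close>-th power of the Erlang tail \<open>\<Sum>k<B. (t/\<rho>)\<^sup>k exp (-t/\<rho>) / k!\<close>. Expanding this
  power by the multinomial theorem and integrating term by term gives exactly \<open>\<rho> \<Psi>\<^sub>G\<close>.
\<close>

section \<open>Multinomial theorem over weak compositions\<close>

text \<open>Splitting off the last entry \<open>k\<close> leaves a vector with total
  \<open>n - k\<close>. This is the recursion behind the induction on the number of summands in
  \<open>multinomial_theorem\<close>.\<close>

lemma weak_compositions_Suc:
  "weak_compositions (Suc B) n =
     (\<lambda>(k, b). b(Suc B := k)) ` (SIGMA k:{..n}. weak_compositions B (n - k))"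
proof (intro equalityI subsetI)
  fix b assume b: "b \<in> weak_compositions (Suc B) n"
  \<comment> \<open>Resetting the dropped entry to \<open>undefined\<close> makes the shortened
    vector extensional on \<open>{1..B}\<close>.\<close>
  let ?c = "b(Suc B := undefined)"
  have s: "(\<Sum>t=1..B. b t) + b (Suc B) = n"
    and e: "b \<in> {1..Suc B} \<rightarrow>\<^sub>E UNIV"
    using b by (auto simp: weak_compositions_def)
  have "(\<Sum>t=1..B. ?c t) = n - b (Suc B)"
    using s by auto
  moreover have "?c \<in> {1..B} \<rightarrow>\<^sub>E UNIV"
    using e by (auto simp: PiE_iff extensional_def)
  ultimately have "(b (Suc B), ?c) \<in> (SIGMA k:{..n}. weak_compositions B (n - k))"
    using s by (auto simp: weak_compositions_def)
  moreover have "b = (\<lambda>(k, b). b(Suc B := k)) (b (Suc B), ?c)"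
    by simp
  ultimately show "b \<in> (\<lambda>(k, b). b(Suc B := k)) ` (SIGMA k:{..n}. weak_compositions B (n - k))"
    by blast
next
  fix b assume "b \<in> (\<lambda>(k, b). b(Suc B := k)) ` (SIGMA k:{..n}. weak_compositions B (n - k))"
  then obtain k c where kc: "k \<le> n" "c \<in> weak_compositions B (n - k)" "b = c(Suc B := k)"
    by auto
  then have "(\<Sum>t=1..B. c t) = n - k" by (simp add: weak_compositions_def)
  with kc show "b \<in> weak_compositions (Suc B) n"
    by (auto simp: weak_compositions_def PiE_iff extensional_def)
qed

text \<open>Appending an entry loses nothing: every shorter vector has the value
  \<open>undefined\<close> at \<open>Suc B\<close>, so overwriting that position is reversible. This
  permits reindexing sums along the recursion.\<close>

lemma inj_on_weak_compositions_Suc: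
  "inj_on (\<lambda>(k, b). b(Suc B := k)) (SIGMA k:{..n}. weak_compositions B (n - k))"
proof (rule inj_onI, clarsimp)
  fix k k' b b'
  assume b: "b \<in> weak_compositions B (n - k)" "b' \<in> weak_compositions B (n - k')"
    and eq: "b(Suc B := k) = b'(Suc B := k')"
  have "b (Suc B) = b' (Suc B)"
    using b by (simp add: weak_compositions_def PiE_iff extensional_def)
  with eq show "k = k' \<and> b = b'"
    by (metis fun_upd_eqD fun_upd_triv fun_upd_upd)
qed

text \<open>By induction on \<open>B\<close>: the binomial theorem separates the last summand, and
  the induction hypothesis expands the remaining power.\<close>

lemma multinomial_theorem:
  fixes x :: "nat \<Rightarrow> real"
  shows "(\<Sum>t=1..B. x t) ^ n =
    (\<Sum>b\<in>weak_compositions B n. multinomial B n b * (\<Prod>t=1..B. x t ^ b t))"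
proof (induction B arbitrary: n)
  case 0
  \<comment> \<open>The empty vector has total 0, so the sum is 1 for \<open>n = 0\<close> and empty
    otherwise, matching the powers of the empty sum.\<close>
  have "weak_compositions 0 n = (if n = 0 then {\<lambda>_. undefined} else {})"
    by (auto simp: weak_compositions_def)
  then show ?case by (simp add: multinomial_def)
next
  case (Suc B)
  let ?t = "\<lambda>B n b. multinomial B n b * (\<Prod>t=1..B. x t ^ b t)"
  \<comment> \<open>The multinomial coefficient is the binomial coefficient for the last entry times
    the multinomial coefficient of the rest; the factor \<open>fact (n - k)\<close> cancels.\<close>
  have step: "?t (Suc B) n (b(Suc B := k)) =
      of_nat (n choose k) * x (Suc B) ^ k * ?t B (n - k) b" if "k \<le> n" for k b
  proof -
    have p: "(\<Prod>t=1..B. x t ^ (b(Suc B := k)) t) = (\<Prod>t=1..B. x t ^ b t)"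
      "(\<Prod>t=1..B. fact ((b(Suc B := k)) t) :: real) = (\<Prod>t=1..B. fact (b t))"
      by (auto intro!: prod.cong)
    show ?thesis
      using that by (simp add: p multinomial_def binomial_fact field_simps del: fun_upd_apply)
        (simp add: field_simps)
  qed
  have "(\<Sum>t=1..Suc B. x t) ^ n = (x (Suc B) + (\<Sum>t=1..B. x t)) ^ n"
    by (simp add: add.commute)
  also have "\<dots> = (\<Sum>k\<le>n. of_nat (n choose k) * x (Suc B) ^ k * (\<Sum>t=1..B. x t) ^ (n - k))"
    by (rule binomial_ring)
  also have "\<dots> = (\<Sum>k\<le>n. \<Sum>b\<in>weak_compositions B (n - k). ?t (Suc B) n (b(Suc B := k)))"
    unfolding Suc.IH sum_distrib_left by (intro sum.cong refl step[symmetric]) simp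
  also have "\<dots> = (\<Sum>(k, b)\<in>(SIGMA k:{..n}. weak_compositions B (n - k)).
      ?t (Suc B) n (b(Suc B := k)))"
    by (rule sum.Sigma) (auto simp: finite_weak_compositions)
  also have "\<dots> = sum (?t (Suc B) n) (weak_compositions (Suc B) n)"
    unfolding weak_compositions_Suc
    by (subst sum.reindex[OF inj_on_weak_compositions_Suc]) (simp add: case_prod_unfold)
  finally show ?case .
qed

section \<open>Tail formula and gamma integrals\<close>

text \<open>Layer-cake argument: a nonnegative value is the length of the set of \<open>t\<close> in
  \<open>[0, X \<omega>)\<close>, and Tonelli's theorem exchanges the two integrals.\<close>

lemma (in sigma_finite_measure) nn_integral_tail:
  fixes X :: "'a \<Rightarrow> real"
  assumes [measurable]: "X \<in> borel_measurable M" and nonneg: "AE \<omega> in M. 0 \<le> X \<omega>"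
  shows "(\<integral>\<^sup>+\<omega>. ennreal (X \<omega>) \<partial>M) =
    (\<integral>\<^sup>+t. emeasure M {\<omega> \<in> space M. t < X \<omega>} * indicator {0..} t \<partial>lborel)"
proof -
  interpret pair_sigma_finite M lborel
    by (intro pair_sigma_finite.intro sigma_finite_measure_axioms sigma_finite_lborel)
  let ?I = "\<lambda>\<omega> t. if 0 \<le> t \<and> t < X \<omega> then 1 else 0 :: ennreal"
  have "(\<integral>\<^sup>+\<omega>. ennreal (X \<omega>) \<partial>M) = (\<integral>\<^sup>+\<omega>. (\<integral>\<^sup>+t. ?I \<omega> t \<partial>lborel) \<partial>M)"
  proof (rule nn_integral_cong_AE, rule AE_mp[OF nonneg], rule AE_I2, rule impI)
    fix \<omega> assume "0 \<le> X \<omega>"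
    have "(\<integral>\<^sup>+t. ?I \<omega> t \<partial>lborel) = (\<integral>\<^sup>+t. indicator {0..<X \<omega>} t \<partial>lborel)"
      by (intro nn_integral_cong) (auto split: split_indicator)
    with \<open>0 \<le> X \<omega>\<close> show "ennreal (X \<omega>) = (\<integral>\<^sup>+t. ?I \<omega> t \<partial>lborel)" by simp
  qed
  also have "\<dots> = (\<integral>\<^sup>+t. (\<integral>\<^sup>+\<omega>. ?I \<omega> t \<partial>M) \<partial>lborel)"
    by (subst Fubini') simp_all
  also have "\<dots> = (\<integral>\<^sup>+t. emeasure M {\<omega> \<in> space M. t < X \<omega>} * indicator {0..} t \<partial>lborel)"
  proof (rule nn_integral_cong)
    fix t :: real
    have "(\<integral>\<^sup>+\<omega>. ?I \<omega> t \<partial>M) =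
        (\<integral>\<^sup>+\<omega>. indicator {0..} t * indicator {\<omega> \<in> space M. t < X \<omega>} \<omega> \<partial>M)"
      by (intro nn_integral_cong) (auto split: split_indicator)
    then show "(\<integral>\<^sup>+\<omega>. ?I \<omega> t \<partial>M) = emeasure M {\<omega> \<in> space M. t < X \<omega>} * indicator {0..} t"
      by (simp add: nn_integral_cmult mult.commute)
  qed
  finally show ?thesis .
qed

text \<open>Up to the factor \<open>1 / l\<close>, this is the \<open>s\<close>-th moment of the
  exponential distribution with rate \<open>l\<close>.\<close>

lemma nn_integral_power_exp:
  fixes l :: real
  assumes "0 < l"
  shows "(\<integral>\<^sup>+t. ennreal (t ^ s * exp (- l * t)) * indicator {0..} t \<partial>lborel) =
    ennreal (fact s / l ^ Suc s)"
proof -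
  have "(\<integral>\<^sup>+t. ennreal (t ^ s * exp (- l * t)) * indicator {0..} t \<partial>lborel) =
      (\<integral>\<^sup>+t. ennreal (1 / l) * ennreal (exponential_density l t * t ^ s) \<partial>lborel)"
    using assms by (intro nn_integral_cong)
      (auto simp: exponential_density_def ennreal_mult'[symmetric] mult_ac split: split_indicator)
  \<comment> \<open>The exponential density is the Erlang density with index 0, which explains the
    zeros in the moment formula.\<close>
  also have "\<dots> = ennreal (1 / l) * ennreal (fact (0 + s) / (fact 0 * l ^ s))"
    using assms by (simp add: nn_integral_cmult nn_integral_erlang_ith_moment del: fact_0)
  also have "\<dots> = ennreal (fact s / l ^ Suc s)"
    using assms by (simp add: ennreal_mult'[symmetric])
  finally show ?thesis .
qed

section \<open>Elementary bounds for minima and logarithms\<close>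

text \<open>Evaluating one function at a minimiser of the other bounds each signed difference. A sum
  on the right, rather than a maximum, is easy to integrate.\<close>

lemma abs_Min_diff_le:
  fixes f g :: "'i \<Rightarrow> real"
  assumes "finite I" "I \<noteq> {}"
  shows "\<bar>(MIN i\<in>I. f i) - (MIN i\<in>I. g i)\<bar> \<le> (\<Sum>i\<in>I. \<bar>f i - g i\<bar>)"
proof -
  have le: "(MIN i\<in>I. u i) - (MIN i\<in>I. v i) \<le> (\<Sum>i\<in>I. \<bar>u i - v i\<bar>)" for u v :: "'i \<Rightarrow> real"
  proof -
    have "Min (v ` I) \<in> v ` I" using assms by (intro Min_in) auto
    then obtain i where i: "i \<in> I" "(MIN i\<in>I. v i) = v i" by auto
    have "(MIN i\<in>I. u i) \<le> u i" using assms i by simp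
    moreover have "\<bar>u i - v i\<bar> \<le> (\<Sum>i\<in>I. \<bar>u i - v i\<bar>)"
      by (rule member_le_sum) (use assms i in auto)
    ultimately show ?thesis using i by linarith
  qed
  show ?thesis using le[of f g] le[of g f] by (simp add: abs_le_iff abs_minus_commute)
qed

text \<open>For \<open>x \<le> 1\<close> this is the Taylor bound; for larger \<open>x\<close> both
  terms lie between 0 and \<open>x\<close>, and \<open>x\<close> is at most its square.\<close>

lemma abs_ln_one_plus_diff_le:
  fixes x :: real
  assumes "0 \<le> x"
  shows "\<bar>ln (1 + x) - x\<bar> \<le> x\<^sup>2"
proof (cases "x \<le> 1")
  case True
  with assms show ?thesis by (rule abs_ln_one_plus_x_minus_x_bound_nonneg)
next
  case False
  then have "x * 1 \<le> x * x" by (intro mult_left_mono) auto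
  moreover have "0 \<le> ln (1 + x)" "ln (1 + x) \<le> x"
    using assms by (auto intro: ln_add_one_self_le_self)
  ultimately show ?thesis by (simp add: power2_eq_square)
qed

section \<open>Expected minimum of independent Erlang variables\<close>

text \<open>The minimum exceeds \<open>t\<close> exactly when every variable does, so independence
  factors the probability.\<close>

lemma (in prob_space) prob_Min_gt:
  fixes S :: "'i \<Rightarrow> 'a \<Rightarrow> real"
  assumes "finite I" "I \<noteq> {}" "indep_vars (\<lambda>_. borel) S I"
  shows "\<P>(\<omega> in M. t < (MIN i\<in>I. S i \<omega>)) = (\<Prod>i\<in>I. \<P>(\<omega> in M. t < S i \<omega>))"
proof -
  have "{\<omega> \<in> space M. t < (MIN i\<in>I. S i \<omega>)} = (\<Inter>i\<in>I. S i -` {t<..} \<inter> space M)"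
    using assms by auto
  then have "\<P>(\<omega> in M. t < (MIN i\<in>I. S i \<omega>)) = (\<Prod>i\<in>I. prob (S i -` {t<..} \<inter> space M))"
    using indep_varsD_finite[OF assms(3,2,1), of "\<lambda>_. {t<..}"] by simp
  also have "\<dots> = (\<Prod>i\<in>I. \<P>(\<omega> in M. t < S i \<omega>))"
    by (intro prod.cong refl arg_cong[where f = prob]) auto
  finally show ?thesis .
qed

lemma Psi_nonneg: "0 \<le> Psi B G"
  unfolding Psi_def multinomial_def
  by (intro sum_nonneg mult_nonneg_nonneg divide_nonneg_nonneg prod_nonneg) auto

text \<open>The base of the power is the Erlang survival function of shape \<open>B\<close> and rate
  \<open>l\<close>. Its multinomial expansion consists of multiples of
  \<open>t ^ s * exp (- l * G * t)\<close>; integrating each cancels all powers of \<open>l\<close>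
  except \<open>1 / l\<close> and leaves the terms of \<open>Psi\<close>.\<close>

lemma nn_integral_erlang_tail_power:
  fixes l :: real
  assumes "0 < l" "1 \<le> G"
  shows "(\<integral>\<^sup>+t. ennreal ((\<Sum>k=1..B. (l * t) ^ (k - 1) * exp (- l * t) / fact (k - 1)) ^ G)
           * indicator {0..} t \<partial>lborel) = ennreal (Psi B G / l)"
proof -
  \<comment> \<open>\<open>s b\<close> is the power of \<open>t\<close> in the term of
    \<open>b\<close>, and \<open>c b\<close> collects its factors independent of
    \<open>t\<close>.\<close>
  define s where "s b = (\<Sum>k=1..B. (k - 1) * b k)" for b :: "nat \<Rightarrow> nat"
  define c where "c b = multinomial B G b * l ^ s b / (\<Prod>k=1..B. fact (k - 1) ^ b k)"
    for b :: "nat \<Rightarrow> nat"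
  have c0: "0 \<le> c b" for b
    using assms unfolding c_def multinomial_def
    by (intro divide_nonneg_nonneg mult_nonneg_nonneg prod_nonneg) auto
  have expand: "(\<Sum>k=1..B. (l * t) ^ (k - 1) * exp (- l * t) / fact (k - 1)) ^ G =
      (\<Sum>b\<in>weak_compositions B G. c b * (t ^ s b * exp (- (l * real G) * t)))" for t
  proof (subst multinomial_theorem, intro sum.cong refl)
    fix b assume "b \<in> weak_compositions B G"
    then have G: "(\<Sum>k=1..B. b k) = G" by (simp add: weak_compositions_def)
    have "(\<Prod>k=1..B. ((l * t) ^ (k - 1) * exp (- l * t) / fact (k - 1)) ^ b k) =
        (\<Prod>k=1..B. (l * t) ^ ((k - 1) * b k)) * (\<Prod>k=1..B. exp (- l * t) ^ b k)
          / (\<Prod>k=1..B. fact (k - 1) ^ b k)"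
      by (simp add: power_mult_distrib power_divide power_mult prod.distrib prod_dividef)
    also have "(\<Prod>k=1..B. (l * t) ^ ((k - 1) * b k)) = l ^ s b * t ^ s b"
      by (simp add: power_sum s_def power_mult_distrib prod.distrib)
    \<comment> \<open>The entries of \<open>b\<close> sum to \<open>G\<close>, so the exponentials
      combine into one with rate \<open>l * G\<close>, the same for every \<open>b\<close>.\<close>
    also have "(\<Prod>k=1..B. exp (- l * t) ^ b k) = exp (- (l * real G) * t)"
      unfolding power_sum[symmetric] G by (simp add: exp_of_nat_mult[symmetric] mult_ac)
    finally show "multinomial B G b *
        (\<Prod>k=1..B. ((l * t) ^ (k - 1) * exp (- l * t) / fact (k - 1)) ^ b k) =
        c b * (t ^ s b * exp (- (l * real G) * t))"
      by (simp add: c_def)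
  qed
  have "(\<integral>\<^sup>+t. ennreal ((\<Sum>k=1..B. (l * t) ^ (k - 1) * exp (- l * t) / fact (k - 1)) ^ G)
           * indicator {0..} t \<partial>lborel) =
      (\<integral>\<^sup>+t. (\<Sum>b\<in>weak_compositions B G. ennreal (c b) *
         (ennreal (t ^ s b * exp (- (l * real G) * t)) * indicator {0..} t)) \<partial>lborel)"
    unfolding expand
    by (intro nn_integral_cong)
       (auto simp: c0 ennreal_mult'[symmetric] sum_nonneg split: split_indicator)
  also have "\<dots> = (\<Sum>b\<in>weak_compositions B G. ennreal (c b) *
      (\<integral>\<^sup>+t. ennreal (t ^ s b * exp (- (l * real G) * t)) * indicator {0..} t \<partial>lborel))"
    by (simp add: nn_integral_sum nn_integral_cmult)
  also have "\<dots> = (\<Sum>b\<in>weak_compositions B G.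
      ennreal (c b * (fact (s b) / (l * real G) ^ Suc (s b))))"
    using assms c0 by (intro sum.cong refl) (subst nn_integral_power_exp, auto simp: ennreal_mult'[OF c0] simp del: times_divide_eq_right power_Suc)
  also have "\<dots> = ennreal (\<Sum>b\<in>weak_compositions B G. c b * (fact (s b) / (l * real G) ^ Suc (s b)))"
    using assms c0 by (intro sum_ennreal) auto
  also have "(\<Sum>b\<in>weak_compositions B G. c b * (fact (s b) / (l * real G) ^ Suc (s b))) = Psi B G / l"
    unfolding Psi_def sum_divide_distrib
  proof (intro sum.cong refl)
    fix b
    have "real G powi (- 1 - int (s b)) = inverse (real G ^ Suc (s b))"
    proof -
      have "- 1 - int (s b) = - int (Suc (s b))" by simp
      then show ?thesis by (simp only: power_int_minus power_int_of_nat)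
    qed
    then show "c b * (fact (s b) / (l * real G) ^ Suc (s b)) =
        multinomial B G b * (real G powi (- 1 - int (\<Sum>t=1..B. (t - 1) * b t)) /
          (\<Prod>t=1..B. fact (t - 1) ^ b t)) * fact (\<Sum>t=1..B. (t - 1) * b t) / l"
      using assms unfolding s_def[symmetric] c_def by (simp add: field_simps)
  qed
  finally show ?thesis .
qed

text \<open>Integrating the tail of the minimum, which is the \<open>card I\<close>-th power of the
  common Erlang tail, gives both integrability and the value.\<close>

lemma (in prob_space) has_bochner_integral_Min_erlang:
  fixes S :: "'i \<Rightarrow> 'a \<Rightarrow> real"
  assumes "1 \<le> B" "0 < l" and I: "finite I" "I \<noteq> {}"
    and indep: "indep_vars (\<lambda>_. borel) S I"
    and dist: "\<And>i. i \<in> I \<Longrightarrow> distributed M lborel (S i) (erlang_density (B - 1) l)"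
  shows "has_bochner_integral M (\<lambda>\<omega>. MIN i\<in>I. S i \<omega>) (Psi B (card I) / l)"
proof (rule has_bochner_integral_nn_integral)
  have S[measurable]: "S i \<in> borel_measurable M" if "i \<in> I" for i
    using distributed_measurable[OF dist[OF that]] by simp
  show meas: "(\<lambda>\<omega>. MIN i\<in>I. S i \<omega>) \<in> borel_measurable M"
    using I by (intro borel_measurable_Min) auto
  have "AE \<omega> in M. \<forall>i\<in>I. 0 \<le> S i \<omega>"
  proof (rule AE_finite_allI[OF I(1)])
    fix i assume "i \<in> I"
    show "AE \<omega> in M. 0 \<le> S i \<omega>"
      by (subst distributed_AE2[OF dist[OF \<open>i \<in> I\<close>]]) (auto simp: erlang_density_def)
  qed
  then show nonneg: "AE \<omega> in M. 0 \<le> (MIN i\<in>I. S i \<omega>)"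
    using I by (auto elim!: eventually_mono)
  have tail: "\<P>(\<omega> in M. t < S i \<omega>) = (\<Sum>k=1..B. (l * t) ^ (k - 1) * exp (- l * t) / fact (k - 1))"
    if "i \<in> I" "0 \<le> t" for i t
  proof -
    have "\<P>(\<omega> in M. t < S i \<omega>) = (\<Sum>n\<le>B - 1. (l * t) ^ n * exp (- l * t) / fact n)"
      using erlang_distributed_gt[OF dist[OF that(1)] assms(2) that(2)] that(2)
      by (simp add: erlang_CDF_def)
    \<comment> \<open>The shift \<open>k = n + 1\<close> adapts the tail to the indexing of
      \<open>Psi\<close>; \<open>1 \<le> B\<close> makes the truncated \<open>B - 1\<close> the
      correct upper limit.\<close>
    also have "\<dots> = (\<Sum>k=1..B. (l * t) ^ (k - 1) * exp (- l * t) / fact (k - 1))"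
      by (rule sum.reindex_bij_witness[of _ "\<lambda>k. k - 1" Suc]) (use assms(1) in auto)
    finally show ?thesis .
  qed
  have "(\<integral>\<^sup>+\<omega>. ennreal (MIN i\<in>I. S i \<omega>) \<partial>M) =
      (\<integral>\<^sup>+t. emeasure M {\<omega> \<in> space M. t < (MIN i\<in>I. S i \<omega>)} * indicator {0..} t \<partial>lborel)"
    by (rule nn_integral_tail[OF meas nonneg])
  also have "\<dots> = (\<integral>\<^sup>+t. ennreal ((\<Sum>k=1..B. (l * t) ^ (k - 1) * exp (- l * t) / fact (k - 1)) ^ card I)
           * indicator {0..} t \<partial>lborel)"
    by (intro nn_integral_cong)
       (auto simp: emeasure_eq_measure prob_Min_gt[OF I indep] tail split: split_indicator)
  also have "\<dots> = ennreal (Psi B (card I) / l)"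
    using assms by (intro nn_integral_erlang_tail_power) (auto simp: Suc_le_eq card_gt_0_iff)
  finally show "(\<integral>\<^sup>+\<omega>. ennreal (MIN i\<in>I. S i \<omega>) \<partial>M) = ennreal (Psi B (card I) / l)" .
  show "0 \<le> Psi B (card I) / l"
    using assms by (simp add: Psi_nonneg)
qed

section \<open>Independence within and between groups\<close>

text \<open>Different rows are disjoint blocks of an independent family, and each sum is a
  measurable function of its own block.\<close>

lemma (in prob_space) indep_vars_row_sums:
  fixes X :: "'i \<Rightarrow> 'j \<Rightarrow> 'a \<Rightarrow> real"
  assumes "indep_vars (\<lambda>_. borel) (\<lambda>(i, j). X i j) (I \<times> J)"
  shows "indep_vars (\<lambda>_. borel) (\<lambda>i \<omega>. \<Sum>j\<in>J. X i j \<omega>) I"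
proof -
  let ?R = "\<lambda>i \<omega>. restrict (\<lambda>p. (case p of (i, j) \<Rightarrow> X i j) \<omega>) ({i} \<times> J)"
  have "indep_vars (\<lambda>i. PiM ({i} \<times> J) (\<lambda>_. borel)) ?R I"
    by (rule indep_vars_restrict[OF assms]) (auto simp: disjoint_family_on_def)
  then have "indep_vars (\<lambda>_. borel) (\<lambda>i \<omega>. \<Sum>j\<in>J. ?R i \<omega> (i, j)) I"
    by (rule indep_vars_compose2) measurable
  then show ?thesis by simp
qed

text \<open>The same block argument with singleton blocks; it supplies the independence needed for
  the distribution of one group sum.\<close>

lemma (in prob_space) indep_vars_row:
  fixes X :: "'i \<Rightarrow> 'j \<Rightarrow> 'a \<Rightarrow> real"
  assumes "indep_vars (\<lambda>_. borel) (\<lambda>(i, j). X i j) (I \<times> J)" "i \<in> I"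
  shows "indep_vars (\<lambda>_. borel) (X i) J"
proof -
  let ?R = "\<lambda>j \<omega>. restrict (\<lambda>p. (case p of (i, j) \<Rightarrow> X i j) \<omega>) {(i, j)}"
  have "indep_vars (\<lambda>j. PiM {(i, j)} (\<lambda>_. borel)) ?R J"
    by (rule indep_vars_restrict[OF assms(1)]) (use assms(2) in \<open>auto simp: disjoint_family_on_def\<close>)
  then have "indep_vars (\<lambda>_. borel) (\<lambda>j \<omega>. ?R j \<omega> (i, j)) J"
    by (rule indep_vars_compose2) measurable
  then show ?thesis by simp
qed

section \<open>Quantitative low-SNR estimate\<close>

text \<open>Linearising the logarithm costs at most the square of each SNR, with mean
  \<open>2 * \<rho>\<^sup>2\<close>. Averaging over users, summing over groups and multiplying by
  the prefactor \<open>card I / ln 2\<close> gives the constant.\<close>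

lemma (in prob_space) acc_avg_rate_bound:
  assumes "1 \<le> B" "0 < \<rho>" and I: "finite I" "I \<noteq> {}"
    and indep: "indep_vars (\<lambda>_. borel) (\<lambda>(g, b). X g b) (I \<times> {1..B})"
    and dist: "\<And>g b. g \<in> I \<Longrightarrow> b \<in> {1..B} \<Longrightarrow>
      distributed M lborel (X g b) (exponential_density (1 / \<rho>))"
  shows "\<bar>acc_avg_rate M I B X - \<rho> * real (card I) / (real B * ln 2) * Psi B (card I)\<bar>
    \<le> 2 * (real (card I))\<^sup>2 / ln 2 * \<rho>\<^sup>2"
proof -
  let ?S = "\<lambda>g \<omega>. \<Sum>b=1..B. X g b \<omega>"
  let ?L = "\<lambda>g \<omega>. 1 / real B * (\<Sum>b=1..B. ln (1 + X g b \<omega>))"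
  let ?E = "\<lambda>\<omega>. \<Sum>g\<in>I. 1 / real B * (\<Sum>b=1..B. (X g b \<omega>)\<^sup>2)"
  have X[measurable]: "X g b \<in> borel_measurable M" if "g \<in> I" "b \<in> {1..B}" for g b
    using distributed_measurable[OF dist[OF that]] by simp
  have indepS: "indep_vars (\<lambda>_. borel) ?S I"
    by (rule indep_vars_row_sums[OF indep])
  \<comment> \<open>The first parameter of \<open>erlang_density\<close> is the shape minus one, so
    \<open>B\<close> exponential variables give the index \<open>B - 1\<close>.\<close>
  have distS: "distributed M lborel (?S g) (erlang_density (B - 1) (1 / \<rho>))" if g: "g \<in> I" for g
  proof -
    have "indep_vars (\<lambda>_. borel) (X g) {1..B}"
      by (rule indep_vars_row[OF indep g])
    then show ?thesis
      using exponential_distributed_sum[of "{1..B}" "1 / \<rho>" "X g"] assms(1,2) dist[OF g] by simp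
  qed
  have min: "has_bochner_integral M (\<lambda>\<omega>. MIN g\<in>I. ?S g \<omega>) (\<rho> * Psi B (card I))"
    using has_bochner_integral_Min_erlang[OF assms(1) _ I indepS distS] assms(2)
    by (simp add: mult.commute)
  have sq: "has_bochner_integral M (\<lambda>\<omega>. (X g b \<omega>)\<^sup>2) (2 * \<rho>\<^sup>2)" if "g \<in> I" "b \<in> {1..B}" for g b
    using has_bochner_integral_erlang_ith_moment[OF _ dist[OF that], of 2] assms(2)
    by (simp add: field_simps)
  have err: "has_bochner_integral M ?E (\<Sum>g\<in>I. 1 / real B * (\<Sum>b=1..B. 2 * \<rho>\<^sup>2))"
    by (intro has_bochner_integral_sum has_bochner_integral_mult_right sq)
  have "AE \<omega> in M. \<forall>g\<in>I. \<forall>b\<in>{1..B}. 0 \<le> X g b \<omega>"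
  proof (intro AE_finite_allI I(1) finite_atLeastAtMost)
    fix g b assume gb: "g \<in> I" "b \<in> {1..B}"
    show "AE \<omega> in M. 0 \<le> X g b \<omega>"
      by (subst distributed_AE2[OF dist[OF gb]]) (auto simp: erlang_density_def)
  qed
  then have bound: "AE \<omega> in M. \<bar>(MIN g\<in>I. ?L g \<omega>) - 1 / real B * (MIN g\<in>I. ?S g \<omega>)\<bar> \<le> ?E \<omega>"
  proof (rule eventually_mono)
    fix \<omega> assume nn: "\<forall>g\<in>I. \<forall>b\<in>{1..B}. 0 \<le> X g b \<omega>"
    \<comment> \<open>Multiplication by the nonnegative constant \<open>1 / B\<close> is monotone
      and hence passes through the minimum.\<close>
    have "mono ((*) (1 / real B))" by (auto intro!: monoI divide_right_mono)
    then have "1 / real B * (MIN g\<in>I. ?S g \<omega>) = (MIN g\<in>I. 1 / real B * ?S g \<omega>)"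
      using I by (subst mono_Min_commute) (auto simp: image_image)
    then have "\<bar>(MIN g\<in>I. ?L g \<omega>) - 1 / real B * (MIN g\<in>I. ?S g \<omega>)\<bar>
        \<le> (\<Sum>g\<in>I. \<bar>?L g \<omega> - 1 / real B * ?S g \<omega>\<bar>)"
      using abs_Min_diff_le[OF I, of "\<lambda>g. ?L g \<omega>" "\<lambda>g. 1 / real B * ?S g \<omega>"] by simp
    also have "\<dots> \<le> ?E \<omega>"
    proof (rule sum_mono)
      fix g assume g: "g \<in> I"
      have "\<bar>?L g \<omega> - 1 / real B * ?S g \<omega>\<bar> = 1 / real B * \<bar>\<Sum>b=1..B. ln (1 + X g b \<omega>) - X g b \<omega>\<bar>"
        by (simp add: sum_subtractf right_diff_distrib[symmetric] diff_divide_distrib[symmetric] abs_div)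
      also have "\<dots> \<le> 1 / real B * (\<Sum>b=1..B. \<bar>ln (1 + X g b \<omega>) - X g b \<omega>\<bar>)"
        by (intro mult_left_mono sum_abs) auto
      also have "\<dots> \<le> 1 / real B * (\<Sum>b=1..B. (X g b \<omega>)\<^sup>2)"
        using nn g by (intro mult_left_mono sum_mono abs_ln_one_plus_diff_le) auto
      finally show "\<bar>?L g \<omega> - 1 / real B * ?S g \<omega>\<bar> \<le> 1 / real B * (\<Sum>b=1..B. (X g b \<omega>)\<^sup>2)" .
    qed
    finally show "\<bar>(MIN g\<in>I. ?L g \<omega>) - 1 / real B * (MIN g\<in>I. ?S g \<omega>)\<bar> \<le> ?E \<omega>" .
  qed
  have L[measurable]: "(\<lambda>\<omega>. MIN g\<in>I. ?L g \<omega>) \<in> borel_measurable M"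
    using I by (intro borel_measurable_Min) auto
  note intS = has_bochner_integral_mult_right[OF min, of "1 / real B"]
  \<comment> \<open>The difference is dominated by the integrable \<open>?E\<close>. Adding back the
    scaled minimum of the linear sums then yields integrability of the logarithmic minimum, so the
    expectations may be subtracted.\<close>
  have intD: "integrable M (\<lambda>\<omega>. (MIN g\<in>I. ?L g \<omega>) - 1 / real B * (MIN g\<in>I. ?S g \<omega>))"
  proof (rule Bochner_Integration.integrable_bound[OF integrable.intros[OF err]])
    show "(\<lambda>\<omega>. (MIN g\<in>I. ?L g \<omega>) - 1 / real B * (MIN g\<in>I. ?S g \<omega>)) \<in> borel_measurable M"
      using L borel_measurable_integrable[OF integrable.intros[OF intS]]
      by (rule borel_measurable_diff)
    show "AE \<omega> in M. norm ((MIN g\<in>I. ?L g \<omega>) - 1 / real B * (MIN g\<in>I. ?S g \<omega>)) \<le> norm (?E \<omega>)"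
      using bound unfolding real_norm_def
      by eventually_elim (erule order_trans, rule abs_ge_self)
  qed
  have "integrable M (\<lambda>\<omega>. MIN g\<in>I. ?L g \<omega>)"
    using Bochner_Integration.integrable_add[OF intD integrable.intros[OF intS]]
    by simp
  then have "\<bar>expectation (\<lambda>\<omega>. MIN g\<in>I. ?L g \<omega>) - 1 / real B * (\<rho> * Psi B (card I))\<bar> =
      \<bar>expectation (\<lambda>\<omega>. (MIN g\<in>I. ?L g \<omega>) - 1 / real B * (MIN g\<in>I. ?S g \<omega>))\<bar>"
    using intS assms(1) by (auto simp: has_bochner_integral_iff)
  also have "\<dots> \<le> expectation (\<lambda>\<omega>. \<bar>(MIN g\<in>I. ?L g \<omega>) - 1 / real B * (MIN g\<in>I. ?S g \<omega>)\<bar>)"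
    by (rule integral_abs_bound)
  also have "\<dots> \<le> expectation ?E"
    using intD bound integrable.intros[OF err] by (intro integral_mono_AE) auto
  also have "\<dots> = 2 * real (card I) * \<rho>\<^sup>2"
    using has_bochner_integral_integral_eq[OF err] assms(1) by (simp add: field_simps)
  finally have main: "\<bar>expectation (\<lambda>\<omega>. MIN g\<in>I. ?L g \<omega>) - 1 / real B * (\<rho> * Psi B (card I))\<bar>
      \<le> 2 * real (card I) * \<rho>\<^sup>2" .
  have "acc_avg_rate M I B X - \<rho> * real (card I) / (real B * ln 2) * Psi B (card I) =
      real (card I) / ln 2 *
        (expectation (\<lambda>\<omega>. MIN g\<in>I. ?L g \<omega>) - 1 / real B * (\<rho> * Psi B (card I)))"
    by (simp add: acc_avg_rate_def field_simps)
  then have "\<bar>acc_avg_rate M I B X - \<rho> * real (card I) / (real B * ln 2) * Psi B (card I)\<bar> =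
      real (card I) / ln 2 *
        \<bar>expectation (\<lambda>\<omega>. MIN g\<in>I. ?L g \<omega>) - 1 / real B * (\<rho> * Psi B (card I))\<bar>"
    by (simp only: abs_mult) simp
  also have "\<dots> \<le> real (card I) / ln 2 * (2 * real (card I) * \<rho>\<^sup>2)"
    by (intro mult_left_mono main) auto
  also have "\<dots> = 2 * (real (card I))\<^sup>2 / ln 2 * \<rho>\<^sup>2"
    by (simp add: power2_eq_square)
  finally show ?thesis .
qed

text \<open>The probability space may vary with \<open>\<rho>\<close>: the error bound depends only
  on \<open>G\<close> and \<open>\<rho>\<close>, so it applies at each positive
  \<open>\<rho>\<close> separately. The quadratic error is then \<open>o(\<rho>)\<close>.\<close>

theorem lemma3:
  fixes \<Lambda> B G :: nat and \<gamma> :: real and \<G> :: "nat set"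
    and M :: "real \<Rightarrow> 'a measure"
    and SNR :: "real \<Rightarrow> nat \<Rightarrow> nat \<Rightarrow> 'a \<Rightarrow> real"
  assumes "B \<ge> 1" and "G \<ge> 1"
    and "0 \<le> \<gamma>" and "\<gamma> \<le> 1"
    and "real \<Lambda> * \<gamma> \<in> \<int>" and "real \<Lambda> * \<gamma> + 1 \<le> real \<Lambda>"
    and "\<G> \<subseteq> {1..\<Lambda>}" and "card \<G> = G" and "real G = real \<Lambda> * \<gamma> + 1"
    and "\<And>\<rho>. \<rho> > 0 \<Longrightarrow> prob_space (M \<rho>)"
    and "\<And>\<rho>. \<rho> > 0 \<Longrightarrow>
           prob_space.indep_vars (M \<rho>) (\<lambda>_. borel) (\<lambda>(g, b). SNR \<rho> g b) ({1..\<Lambda>} \<times> {1..B})"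
    and "\<And>\<rho> g b. \<rho> > 0 \<Longrightarrow> g \<in> {1..\<Lambda>} \<Longrightarrow> b \<in> {1..B} \<Longrightarrow>
           distributed (M \<rho>) lborel (SNR \<rho> g b) (exponential_density (1 / \<rho>))"
  shows "(\<lambda>\<rho>. acc_avg_rate (M \<rho>) \<G> B (SNR \<rho>) - \<rho> * real G / (real B * ln 2) * Psi B G)
           \<in> o[at_right 0](\<lambda>\<rho>. \<rho>)"
proof (rule landau_o.big_small_trans)
  show "(\<lambda>\<rho>. acc_avg_rate (M \<rho>) \<G> B (SNR \<rho>) - \<rho> * real G / (real B * ln 2) * Psi B G)
      \<in> O[at_right 0](\<lambda>\<rho>. \<rho>\<^sup>2)"
  proof (rule bigoI)
    show "\<forall>\<^sub>F \<rho> in at_right 0.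
        norm (acc_avg_rate (M \<rho>) \<G> B (SNR \<rho>) - \<rho> * real G / (real B * ln 2) * Psi B G)
          \<le> 2 * (real G)\<^sup>2 / ln 2 * norm (\<rho>\<^sup>2)"
      using eventually_at_right_less[of 0]
    proof eventually_elim
      case (elim \<rho>)
      then interpret prob_space "M \<rho>" using assms(10) by blast
      have "finite \<G>" "\<G> \<noteq> {}"
        using assms(2,7,8) by (auto intro: finite_subset)
      \<comment> \<open>Only the served groups enter the minimum, so independence is restricted to
        their users.\<close>
      moreover have "indep_vars (\<lambda>_. borel) (\<lambda>(g, b). SNR \<rho> g b) (\<G> \<times> {1..B})"
        by (rule indep_vars_subset[OF assms(11)[OF elim]]) (use assms(7) in auto)
      ultimately show ?case
        using acc_avg_rate_bound[of B \<rho> \<G> "SNR \<rho>"] assms(1,7,8,12) elim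
        by (simp add: subset_iff)
    qed
  qed
  have "((\<lambda>\<rho>::real. \<rho>\<^sup>2 / \<rho>) \<longlongrightarrow> 0) (at_right 0)"
  proof (rule Lim_transform_eventually)
    show "((\<lambda>\<rho>::real. \<rho>) \<longlongrightarrow> 0) (at_right 0)" by (rule tendsto_ident_at)
    show "\<forall>\<^sub>F \<rho>::real in at_right 0. \<rho> = \<rho>\<^sup>2 / \<rho>"
      using eventually_at_right_less[of 0] by eventually_elim (simp add: power2_eq_square)
  qed
  then show "(\<lambda>\<rho>. \<rho>\<^sup>2) \<in> o[at_right 0](\<lambda>\<rho>. \<rho> :: real)"
    by (rule smalloI_tendsto)
       (use eventually_at_right_less[of "0::real"] in \<open>auto elim!: eventually_mono\<close>)
qed

end
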